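(* Let $f\in H^2(\mathbb{D}^2)$ have no zeros in $\mathbb{D}^2$, and let $n\ge0$ be an integer. Then the $n$-th optimal polynomial approximant $p_n^*[f]$ to $1/f$ in $H^2(\mathbb{D}^2)$ has no zeros in $\mathbb{D}^2$ if and only if, for every $\alpha\in\mathbb{D}^2$, the $(n+1)\times(n+1)$ matrix $$\begin{bmatrix} \langle k_\alpha, f \rangle & \langle f, \chi_1 f\rangle & \dots & \langle f, \chi_n f\rangle\\ \langle k_\alpha, \chi_1 f \rangle & \langle \chi_1 f, \chi_1 f\rangle & \dots & \langle \chi_1 f, \chi_n f\rangle\\ \vdots & \vdots & \ddots & \vdots \\ \langle k_\alpha, \chi_n f \rangle & \langle \chi_n f, \chi_1 f\rangle & \dots & \langle \chi_n f, \chi_n f\rangle \end{bmatrix}$$ is invertible.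
   Context: $\mathbb{D}$ is the open unit disk in $\mathbb{C}$ and $H^2(\mathbb{D}^2)$ is the Hardy space on the bidisk: holomorphic functions on $\mathbb{D}^2$ with square-summable Taylor coefficients, with inner product $\langle f,g\rangle=\sum_{i,j\ge0}a_{i,j}\overline{b_{i,j}}$ for $f=\sum a_{i,j}z^iw^j$, $g=\sum b_{i,j}z^iw^j$ (equivalently, the $L^2(\mathbb{T}^2)$ inner product of boundary values with respect to normalized Lebesgue measure). For $\alpha=(\alpha_1,\alpha_2)\in\mathbb{D}^2$, $k_\alpha(z,w)=\frac{1}{(1-\overline{\alpha_1}z)(1-\overline{\alpha_2}w)}$ is the reproducing kernel at $\alpha$, so $g(\alpha)=\langle g,k_\alpha\rangle$ for all $g\in H^2(\mathbb{D}^2)$. The monomials in $z,w$ are enumerated in degree lexicographic order (increasing total degree; within total degree $d$ the order is $z^d, z^{d-1}w,\dots,w^d$): $\chi_0=1,\ \chi_1=z,\ \chi_2=w,\ \chi_3=z^2,\ \chi_4=zw,\ \chi_5=w^2,\dots$. Put $\mathcal{P}_n=\operatorname{span}\{\chi_0,\dots,\chi_n\}$. For $f\in H^2(\mathbb{D}^2)$ not identically zero and $n\ge0$, the $n$-th optimal polynomial approximant (OPA) to $1/f$, denoted $p_n^*[f]$, is the unique $p\in\mathcal{P}_n$ minimizing $\|pf-1\|$ over $\mathcal{P}_n$; equivalently, $p_n^*[f]f$ is the orthogonal projection of $1$ onto $\mathcal{P}_nf=\{pf:p\in\mathcal{P}_n\}$. *)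

theory Defs
  imports "HOL-Analysis.Analysis" "HOL-Library.Nat_Bijection" "Jordan_Normal_Form.Matrix"
begin

definition bidisk :: "(complex \<times> complex) set" where
  "bidisk = ball 0 1 \<times> ball 0 1"

text \<open>
  Functions on the bidisk are total functions on \<open>\<complex> \<times> \<complex>\<close>; only their values on
  \<^const>\<open>bidisk\<close> matter. Holomorphy in two variables is Frechet differentiability with a
  complex-linear derivative \<open>(h, k) \<mapsto> a h + b k\<close>.
\<close>

definition holomorphic_on_bidisk :: "(complex \<times> complex \<Rightarrow> complex) \<Rightarrow> bool" where
  "holomorphic_on_bidisk f \<longleftrightarrow>
     (\<forall>x\<in>bidisk. \<exists>a b. (f has_derivative (\<lambda>(h, k). a * h + b * k)) (at x))"

text \<open>The coefficient of \<open>z\<^sup>i w\<^sup>j\<close> in the Taylor expansion at the origin.\<close>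

definition taylor_coeff :: "(complex \<times> complex \<Rightarrow> complex) \<Rightarrow> nat \<times> nat \<Rightarrow> complex" where
  "taylor_coeff f = (\<lambda>(i, j).
     (deriv ^^ i) (\<lambda>z. (deriv ^^ j) (\<lambda>w. f (z, w)) 0) 0 / (fact i * fact j))"

definition hardy2 :: "(complex \<times> complex \<Rightarrow> complex) set" where
  "hardy2 = {f. holomorphic_on_bidisk f \<and>
     (\<lambda>ij. (cmod (taylor_coeff f ij))\<^sup>2) summable_on UNIV}"

definition hardy_inner ::
  "(complex \<times> complex \<Rightarrow> complex) \<Rightarrow> (complex \<times> complex \<Rightarrow> complex) \<Rightarrow> complex" where
  "hardy_inner f g = (\<Sum>\<^sub>\<infinity>ij\<in>UNIV. taylor_coeff f ij * cnj (taylor_coeff g ij))"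

definition hardy_norm :: "(complex \<times> complex \<Rightarrow> complex) \<Rightarrow> real" where
  "hardy_norm f = sqrt (Re (hardy_inner f f))"

definition szego_kernel :: "complex \<times> complex \<Rightarrow> complex \<times> complex \<Rightarrow> complex" where
  "szego_kernel \<alpha> = (\<lambda>(z, w). 1 / ((1 - cnj (fst \<alpha>) * z) * (1 - cnj (snd \<alpha>) * w)))"

text \<open>
  \<^const>\<open>prod_decode\<close> inverts \<open>(j, i) \<mapsto> triangle (i + j) + j\<close>, so reading \<open>j\<close> as the exponent
  of \<open>w\<close> and \<open>i\<close> as that of \<open>z\<close> enumerates the monomials in degree lexicographic order.
\<close>

definition deglex_monom :: "nat \<Rightarrow> complex \<times> complex \<Rightarrow> complex" where
  "deglex_monom n = (\<lambda>(z, w). case prod_decode n of (j, i) \<Rightarrow> z ^ i * w ^ j)"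

lemma deglex_monom_index: "deglex_monom (triangle (i + j) + j) (z, w) = z ^ i * w ^ j"
proof -
  have "prod_decode (triangle (i + j) + j) = (j, i)"
    using prod_encode_inverse[of "(j, i)"] by (simp add: prod_encode_def add.commute)
  then show ?thesis by (simp add: deglex_monom_def)
qed

text \<open>\<open>span {\<chi>\<^sub>0, \<dots>, \<chi>\<^sub>n}\<close>, as polynomial functions on \<open>\<complex> \<times> \<complex>\<close>.\<close>

definition deglex_polys :: "nat \<Rightarrow> (complex \<times> complex \<Rightarrow> complex) set" where
  "deglex_polys n = {p. \<exists>c. p = (\<lambda>x. \<Sum>k\<le>n. c k * deglex_monom k x)}"

definition opa :: "nat \<Rightarrow> (complex \<times> complex \<Rightarrow> complex) \<Rightarrow> complex \<times> complex \<Rightarrow> complex" where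
  "opa n f = (THE p. p \<in> deglex_polys n \<and>
     (\<forall>q\<in>deglex_polys n. hardy_norm (\<lambda>x. p x * f x - 1) \<le> hardy_norm (\<lambda>x. q x * f x - 1)))"

text \<open>Rows and columns are numbered from \<open>0\<close> to \<open>n\<close>.\<close>

definition opa_matrix ::
  "nat \<Rightarrow> (complex \<times> complex \<Rightarrow> complex) \<Rightarrow> complex \<times> complex \<Rightarrow> complex mat" where
  "opa_matrix n f \<alpha> = mat (n + 1) (n + 1) (\<lambda>(i, j).
     if j = 0 then hardy_inner (szego_kernel \<alpha>) (\<lambda>x. deglex_monom i x * f x)
     else hardy_inner (\<lambda>x. deglex_monom i x * f x) (\<lambda>x. deglex_monom j x * f x))"

end

theory Submission
  imports Defs "HOL-Complex_Analysis.Cauchy_Integral_Formula" "Jordan_Normal_Form.Determinant"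
begin

text \<open>
  Let \<open>p = \<Sum>\<^sub>k c\<^sub>k \<chi>\<^sub>k\<close> be the optimal approximant. As \<open>\<langle>1, \<chi>\<^sub>j f\<rangle>\<close> is the conjugate of
  \<open>(\<chi>\<^sub>j f)(0, 0)\<close>, the normal equations say that \<open>\<Sum>\<^sub>k c\<^sub>k \<langle>\<chi>\<^sub>k f, \<chi>\<^sub>j f\<rangle>\<close> vanishes for \<open>j > 0\<close> and
  is the conjugate of \<open>f(0, 0) \<noteq> 0\<close> for \<open>j = 0\<close>. So multiplying the matrix at \<open>\<alpha>\<close> by the row vector
  \<open>c\<close> from the left kills every column but the first, where by the reproducing property it leaves
  \<open>p(\<beta>)\<close> times the conjugate of \<open>f(\<alpha>)\<close>, with \<open>\<beta>\<close> the conjugate of \<open>\<alpha>\<close>. If \<open>p(\<beta>) = 0\<close>, then \<open>c\<close> is a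
  nonzero left null vector; if not, then a right null vector has first entry \<open>0\<close>, hence vanishes
  because the Gram matrix of the linearly independent functions \<open>\<chi>\<^sub>k f\<close> is nonsingular. The theorem follows as
  the bidisk is invariant under conjugation.
\<close>

subsection \<open>Holomorphic functions on the bidisk\<close>

lemma circlepath_in_sphere:
  "0 \<le> r \<Longrightarrow> circlepath c r t \<in> sphere c r"
  by (simp add: circlepath dist_norm norm_mult)

lemma continuous_on_circlepath [continuous_intros]:
  "continuous_on A g \<Longrightarrow> continuous_on A (\<lambda>x. circlepath c r (g x))"
  unfolding circlepath by (intro continuous_intros)

text \<open>Parametrising the circle leaves an integral of a jointly continuous function over a
  compact interval. The parameter space is arbitrary so that pairs of a point and a path parameter
  are covered too.\<close>

lemma continuous_on_contour_integral_circlepath: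
  fixes h :: "'a::topological_space \<Rightarrow> complex \<Rightarrow> complex"
  assumes cont: "continuous_on (U \<times> sphere c r) (\<lambda>(x, u). h x u)" and r: "0 \<le> r"
  shows "continuous_on U (\<lambda>x. contour_integral (circlepath c r) (h x))"
proof -
  have "continuous_on (U \<times> cbox 0 1) (\<lambda>y::'a \<times> real. (fst y, circlepath c r (snd y)))"
    by (intro continuous_intros)
  then have "continuous_on (U \<times> cbox 0 1) (\<lambda>y::'a \<times> real. h (fst y) (circlepath c r (snd y)))"
    by (rule continuous_on_compose2[OF cont, of _ "\<lambda>y. (fst y, circlepath c r (snd y))",
          simplified split_beta fst_conv snd_conv])
      (use r circlepath_in_sphere in auto)
  then have "continuous_on (U \<times> cbox 0 1)
      (\<lambda>y::'a \<times> real. h (fst y) (circlepath c r (snd y)) * (2 * pi * \<i> * r * exp (2 * pi * \<i> * snd y)))"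
    by (intro continuous_intros)
  then have "continuous_on U (\<lambda>x. integral (cbox 0 1)
      (\<lambda>t. h x (circlepath c r t) * (2 * pi * \<i> * r * exp (2 * pi * \<i> * t))))"
    by (intro integral_continuous_on_param) (simp add: split_beta)
  then show ?thesis
    by (simp add: contour_integral_integral vector_derivative_circlepath)
qed

text \<open>The Leibniz rule needs a jointly continuous \<open>z\<close>-derivative of the
  integrand. Cauchy's formula writes this derivative as a circle integral again, to which the
  preceding continuity lemma applies.\<close>

lemma holomorphic_on_contour_integral_circlepath:
  fixes h :: "complex \<Rightarrow> complex \<Rightarrow> complex"
  assumes cont: "continuous_on (S \<times> sphere c r) (\<lambda>(z, u). h z u)" and r: "0 \<le> r"
    and S: "open S" and hol: "\<And>u. u \<in> sphere c r \<Longrightarrow> (\<lambda>z. h z u) holomorphic_on S"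
  shows "(\<lambda>z. contour_integral (circlepath c r) (h z)) holomorphic_on S"
proof -
  let ?d = "\<lambda>t. 2 * pi * \<i> * r * exp (2 * pi * \<i> * of_real t)"
  let ?I = "\<lambda>z. integral (cbox 0 1) (\<lambda>t. h z (circlepath c r t) * ?d t)"
  have local: "?I holomorphic_on ball z0 e" if e: "0 < e" "cball z0 e \<subseteq> S" for z0 e
  proof (rule leibniz_rule_holomorphic)
    \<comment> \<open>The circle about \<open>z0\<close> stays fixed while \<open>z\<close> moves
      inside it; this is what makes joint continuity of \<open>?D\<close> accessible.\<close>
    let ?D = "\<lambda>z u. 1 / (2 * of_real pi * \<i>) * contour_integral (circlepath z0 e) (\<lambda>\<zeta>. h \<zeta> u / (\<zeta> - z)\<^sup>2)"
    let ?fx = "\<lambda>z t. ?D z (circlepath c r t) * ?d t"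
    show "((\<lambda>z. h z (circlepath c r t) * ?d t) has_field_derivative ?fx z t) (at z within ball z0 e)"
      if "z \<in> ball z0 e" "t \<in> cbox 0 1" for z t
    proof -
      have "(\<lambda>z. h z (circlepath c r t)) holomorphic_on cball z0 e"
        using hol[OF circlepath_in_sphere[OF r]] e holomorphic_on_subset by blast
      then have "((\<lambda>z. h z (circlepath c r t)) has_field_derivative ?D z (circlepath c r t)) (at z)"
        using that(1) by (intro Cauchy_derivative_integral_circlepath)
          (auto intro: holomorphic_on_imp_continuous_on holomorphic_on_subset)
      then show ?thesis
        using DERIV_cmult_right has_field_derivative_at_within by blast
    qed
    have "continuous_on (cbox 0 1) (\<lambda>t. h z (circlepath c r t))" if "z \<in> ball z0 e" for z
      by (rule continuous_on_compose2[OF cont, of _ "\<lambda>t. (z, circlepath c r t)", simplified split_beta fst_conv snd_conv])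
        (use that e r circlepath_in_sphere in \<open>auto intro!: continuous_intros\<close>)
    then have "continuous_on (cbox 0 1) (\<lambda>t. h z (circlepath c r t) * ?d t)" if "z \<in> ball z0 e" for z
      using that by (intro continuous_intros)
    then show "(\<lambda>t. h z (circlepath c r t) * ?d t) integrable_on cbox 0 1" if "z \<in> ball z0 e" for z
      using that by (intro integrable_continuous)
    let ?B = "ball z0 e \<times> (cbox 0 1 :: real set)"
    have "continuous_on (?B \<times> sphere z0 e) (\<lambda>y. h (snd y) (circlepath c r (snd (fst y))))"
      by (rule continuous_on_compose2[OF cont, of _ "\<lambda>y. (snd y, circlepath c r (snd (fst y)))",
          simplified split_beta fst_conv snd_conv])
        (use e r circlepath_in_sphere in \<open>auto intro!: continuous_intros\<close>)
    \<comment> \<open>The denominator has no zeros: one point lies in the open ball, the other on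
      its bounding sphere.\<close>
    then have "continuous_on (?B \<times> sphere z0 e)
        (\<lambda>y. h (snd y) (circlepath c r (snd (fst y))) / (snd y - fst (fst y))\<^sup>2)"
      by (intro continuous_intros) auto
    then have "continuous_on ?B (\<lambda>x. contour_integral (circlepath z0 e)
        (\<lambda>\<zeta>. h \<zeta> (circlepath c r (snd x)) / (\<zeta> - fst x)\<^sup>2))"
      using e by (intro continuous_on_contour_integral_circlepath) (simp_all add: split_beta)
    then show "continuous_on ?B (\<lambda>(z, t). ?fx z t)"
      unfolding split_beta by (intro continuous_intros)
  qed auto
  have "?I holomorphic_on S"
  proof (subst holomorphic_on_open[OF S], intro ballI)
    fix z0 assume "z0 \<in> S"
    then obtain e where e: "0 < e" "cball z0 e \<subseteq> S"
      using S open_contains_cball by blast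
    then show "\<exists>f'. (?I has_field_derivative f') (at z0)"
      using local[OF e] by (subst (asm) holomorphic_on_open) auto
  qed
  then show ?thesis
    by (simp add: contour_integral_integral vector_derivative_circlepath)
qed

section \<open>Slices and the iterated Taylor expansion\<close>

lemma holomorphic_on_bidisk_slice1:
  assumes "holomorphic_on_bidisk f" "w \<in> ball 0 1"
  shows "(\<lambda>z. f (z, w)) holomorphic_on ball 0 1"
proof (subst holomorphic_on_open, simp, intro ballI)
  fix z :: complex assume "z \<in> ball 0 1"
  then obtain a b where ab: "(f has_derivative (\<lambda>(h, k). a * h + b * k)) (at (z, w))"
    using assms unfolding holomorphic_on_bidisk_def bidisk_def by fastforce
  have "((\<lambda>z. (z, w)) has_derivative (\<lambda>h. (h, 0))) (at z)"
    by (intro derivative_intros)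
  from has_derivative_compose[OF this ab]
  show "\<exists>f'. ((\<lambda>z. f (z, w)) has_field_derivative f') (at z)"
    by (auto simp: has_field_derivative_def mult.commute[of _ a] intro!: exI[of _ a])
qed

lemma holomorphic_on_bidisk_slice2:
  assumes "holomorphic_on_bidisk f" "z \<in> ball 0 1"
  shows "(\<lambda>w. f (z, w)) holomorphic_on ball 0 1"
proof (subst holomorphic_on_open, simp, intro ballI)
  fix w :: complex assume "w \<in> ball 0 1"
  then obtain a b where ab: "(f has_derivative (\<lambda>(h, k). a * h + b * k)) (at (z, w))"
    using assms unfolding holomorphic_on_bidisk_def bidisk_def by fastforce
  have "((\<lambda>w. (z, w)) has_derivative (\<lambda>k. (0, k))) (at w)"
    by (intro derivative_intros)
  from has_derivative_compose[OF this ab]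
  show "\<exists>f'. ((\<lambda>w. f (z, w)) has_field_derivative f') (at w)"
    by (auto simp: has_field_derivative_def mult.commute[of _ b] intro!: exI[of _ b])
qed

lemma holomorphic_on_bidisk_continuous_on:
  assumes "holomorphic_on_bidisk f"
  shows "continuous_on bidisk f"
  using assms unfolding holomorphic_on_bidisk_def
  by (metis continuous_at_imp_continuous_on has_derivative_continuous)

text \<open>Cauchy's formula on a circle of radius 1/2 turns the derivative in \<open>w\<close> into
  a contour integral whose integrand is holomorphic in \<open>z\<close>.\<close>

lemma holomorphic_on_higher_deriv_slice:
  assumes f: "holomorphic_on_bidisk f"
  shows "(\<lambda>z. (deriv ^^ j) (\<lambda>w. f (z, w)) 0) holomorphic_on ball 0 1"
proof -
  let ?c = "circlepath 0 (1/2)"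
  have "(\<lambda>z. contour_integral ?c (\<lambda>u. f (z, u) / (u - 0) ^ Suc j)) holomorphic_on ball 0 1"
  proof (rule holomorphic_on_contour_integral_circlepath)
    have "continuous_on (ball 0 1 \<times> sphere 0 (1/2)) f"
      by (rule continuous_on_subset[OF holomorphic_on_bidisk_continuous_on[OF f]])
        (auto simp: bidisk_def)
    then show "continuous_on (ball 0 1 \<times> sphere 0 (1/2)) (\<lambda>(z, u). f (z, u) / (u - 0) ^ Suc j)"
      unfolding split_beta prod.collapse by (intro continuous_intros) auto
    show "(\<lambda>z. f (z, u) / (u - 0) ^ Suc j) holomorphic_on ball 0 1" if "u \<in> sphere 0 (1/2)" for u
      using that by (intro holomorphic_intros holomorphic_on_bidisk_slice1[OF f]) auto
  qed auto
  then have hol: "(\<lambda>z. fact j / (2 * pi * \<i>) *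
      contour_integral ?c (\<lambda>u. f (z, u) / (u - 0) ^ Suc j)) holomorphic_on ball 0 1"
    by (intro holomorphic_intros)
  have eq: "(deriv ^^ j) (\<lambda>w. f (z, w)) 0 = fact j / (2 * pi * \<i>) *
      contour_integral ?c (\<lambda>u. f (z, u) / (u - 0) ^ Suc j)" if "z \<in> ball 0 1" for z
  proof (rule Cauchy_higher_derivative_integral_circlepath)
    show "(\<lambda>w. f (z, w)) holomorphic_on ball 0 (1/2)"
      by (rule holomorphic_on_subset[OF holomorphic_on_bidisk_slice2[OF f that]]) auto
    show "continuous_on (cball 0 (1/2)) (\<lambda>w. f (z, w))"
      by (rule holomorphic_on_imp_continuous_on,
          rule holomorphic_on_subset[OF holomorphic_on_bidisk_slice2[OF f that]]) auto
  qed auto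
  show ?thesis
    by (rule holomorphic_transform[OF hol]) (rule eq[symmetric])
qed

text \<open>Expand in \<open>w\<close> for fixed \<open>z\<close>, then expand each resulting
  coefficient in \<open>z\<close>. The convergence obtained here is only iterated.\<close>

lemma taylor_iterated_sums:
  assumes f: "holomorphic_on_bidisk f" and z: "z \<in> ball 0 1" and w: "w \<in> ball 0 1"
  obtains g where "\<And>j. (\<lambda>i. taylor_coeff f (i, j) * z ^ i) sums g j"
    and "(\<lambda>j. g j * w ^ j) sums f (z, w)"
proof
  let ?b = "\<lambda>j z. (deriv ^^ j) (\<lambda>w. f (z, w)) 0"
  show "(\<lambda>i. taylor_coeff f (i, j) * z ^ i) sums (?b j z / fact j)" for j
    using sums_divide[OF holomorphic_power_series[OF holomorphic_on_higher_deriv_slice[OF f, of j] z], of "fact j"]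
    by (simp add: taylor_coeff_def mult_ac)
  show "(\<lambda>j. ?b j z / fact j * w ^ j) sums f (z, w)"
    using holomorphic_power_series[OF holomorphic_on_bidisk_slice2[OF f z] w] by simp
qed

subsection \<open>Square-summable families\<close>

definition square_summable :: "('a \<Rightarrow> complex) \<Rightarrow> bool" where
  "square_summable A \<longleftrightarrow> (\<lambda>x. (cmod (A x))\<^sup>2) summable_on UNIV"

definition ell2_inner :: "('a \<Rightarrow> complex) \<Rightarrow> ('a \<Rightarrow> complex) \<Rightarrow> complex" where
  "ell2_inner A B = (\<Sum>\<^sub>\<infinity>x\<in>UNIV. A x * cnj (B x))"

text \<open>The passage from functions to coefficient families, on which all Hilbert space arguments
  are carried out.\<close>

lemma hardy_inner_eq_ell2_inner:
  "hardy_inner f g = ell2_inner (taylor_coeff f) (taylor_coeff g)"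
  by (simp add: hardy_inner_def ell2_inner_def)

lemma square_summable_mult:
  assumes "square_summable A" "square_summable B"
  shows "(\<lambda>x. A x * B x) summable_on UNIV"
proof (rule abs_summable_summable, rule abs_summable_product)
  show "(\<lambda>x. norm (A x * A x)) summable_on UNIV" "(\<lambda>x. norm (B x * B x)) summable_on UNIV"
    using assms by (simp_all add: square_summable_def norm_mult power2_eq_square)
qed

lemma square_summable_cnj: "square_summable A \<Longrightarrow> square_summable (\<lambda>x. cnj (A x))"
  by (simp add: square_summable_def)

lemma square_summable_inner:
  assumes "square_summable A" "square_summable B"
  shows "(\<lambda>x. A x * cnj (B x)) summable_on UNIV"
  using assms by (intro square_summable_mult square_summable_cnj)

lemma square_summable_cmult: "square_summable A \<Longrightarrow> square_summable (\<lambda>x. c * A x)"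
  unfolding square_summable_def
  by (simp add: norm_mult power_mult_distrib summable_on_cmult_right)

lemma square_summable_add:
  assumes "square_summable A" "square_summable B"
  shows "square_summable (\<lambda>x. A x + B x)"
  unfolding square_summable_def
proof (rule summable_on_comparison_test)
  show "(\<lambda>x. 2 * ((cmod (A x))\<^sup>2 + (cmod (B x))\<^sup>2)) summable_on UNIV"
    using assms unfolding square_summable_def by (intro summable_on_cmult_right summable_on_add)
  fix x
  have "(cmod (A x + B x))\<^sup>2 \<le> (cmod (A x) + cmod (B x))\<^sup>2"
    by (intro power_mono norm_triangle_ineq) simp
  also have "\<dots> \<le> 2 * ((cmod (A x))\<^sup>2 + (cmod (B x))\<^sup>2)"
    using sum_squares_bound[of "cmod (A x)" "cmod (B x)"] by (simp add: power2_sum)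
  finally show "(cmod (A x + B x))\<^sup>2 \<le> 2 * ((cmod (A x))\<^sup>2 + (cmod (B x))\<^sup>2)" .
qed auto

lemma square_summable_diff:
  "square_summable A \<Longrightarrow> square_summable B \<Longrightarrow> square_summable (\<lambda>x. A x - B x)"
  using square_summable_add[of A "\<lambda>x. - 1 * B x"] square_summable_cmult[of B "- 1"] by simp

lemma square_summable_sum:
  assumes "\<And>k. k \<in> K \<Longrightarrow> square_summable (U k)"
  shows "square_summable (\<lambda>x. \<Sum>k\<in>K. d k * U k x)"
  using assms
proof (induction K rule: infinite_finite_induct)
  case (insert k K)
  then show ?case
    using square_summable_add[OF square_summable_cmult[of "U k" "d k"]] by simp
qed (simp_all add: square_summable_def)

lemma ell2_inner_commute: "ell2_inner A B = cnj (ell2_inner B A)"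
  by (simp add: ell2_inner_def mult.commute flip: infsum_cnj)

lemma ell2_inner_add_left:
  assumes "square_summable A" "square_summable A'" "square_summable B"
  shows "ell2_inner (\<lambda>x. A x + A' x) B = ell2_inner A B + ell2_inner A' B"
  unfolding ell2_inner_def distrib_right
  by (intro infsum_add square_summable_inner assms)

lemma ell2_inner_cmult_left: "ell2_inner (\<lambda>x. c * A x) B = c * ell2_inner A B"
  by (simp add: ell2_inner_def mult.assoc infsum_cmult_right')

lemma ell2_inner_diff_left:
  assumes "square_summable A" "square_summable A'" "square_summable B"
  shows "ell2_inner (\<lambda>x. A x - A' x) B = ell2_inner A B - ell2_inner A' B"
  using ell2_inner_add_left[OF assms(1) square_summable_cmult[OF assms(2), of "- 1"] assms(3)]
    ell2_inner_cmult_left[of "- 1" A' B] by simp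

lemma ell2_inner_sum_left:
  assumes "\<And>k. k \<in> K \<Longrightarrow> square_summable (U k)" "square_summable B"
  shows "ell2_inner (\<lambda>x. \<Sum>k\<in>K. d k * U k x) B = (\<Sum>k\<in>K. d k * ell2_inner (U k) B)"
  using assms(1)
proof (induction K rule: infinite_finite_induct)
  case (insert k K)
  have "ell2_inner (\<lambda>x. d k * U k x + (\<Sum>k\<in>K. d k * U k x)) B =
      ell2_inner (\<lambda>x. d k * U k x) B + ell2_inner (\<lambda>x. \<Sum>k\<in>K. d k * U k x) B"
    using insert.prems by (intro ell2_inner_add_left square_summable_cmult square_summable_sum assms(2)) auto
  then show ?case
    using insert.IH insert.hyps insert.prems by (simp add: ell2_inner_cmult_left)
qed (simp_all add: ell2_inner_def)

text \<open>The inner product is the sum of the squared moduli, and a nonnegative sum that is at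
  most 0 has only zero terms. The inequality is the form in which minimality delivers the
  assumption.\<close>

lemma ell2_inner_self_eq_0D:
  assumes "square_summable A" "Re (ell2_inner A A) \<le> 0"
  shows "A x = 0"
proof -
  have *: "(\<lambda>x. (cmod (A x))\<^sup>2) summable_on UNIV"
    using assms(1) by (simp add: square_summable_def)
  have "ell2_inner A A = of_real (\<Sum>\<^sub>\<infinity>x\<in>UNIV. (cmod (A x))\<^sup>2)"
    unfolding ell2_inner_def complex_norm_square[symmetric]
    by (intro infsumI has_sum_of_real has_sum_infsum *)
  then have "(cmod (A x))\<^sup>2 = 0"
    using assms(2) * by (intro nonneg_infsum_le_0D[of "\<lambda>x. (cmod (A x))\<^sup>2" UNIV]) auto
  then show ?thesis by simp
qed

lemma ell2_pythagoras:
  assumes R: "square_summable R" and S: "square_summable S" and "ell2_inner S R = 0"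
  shows "Re (ell2_inner (\<lambda>x. R x + S x) (\<lambda>x. R x + S x)) =
    Re (ell2_inner R R) + Re (ell2_inner S S)"
proof -
  have T: "square_summable (\<lambda>x. R x + S x)"
    by (intro square_summable_add R S)
  \<comment> \<open>Additivity in the second argument comes from the first by conjugate
    symmetry.\<close>
  have "ell2_inner R (\<lambda>x. R x + S x) = cnj (ell2_inner R R + ell2_inner S R)"
    by (subst ell2_inner_commute) (simp only: ell2_inner_add_left[OF R S R])
  moreover have "ell2_inner S (\<lambda>x. R x + S x) = cnj (ell2_inner R S + ell2_inner S S)"
    by (subst ell2_inner_commute) (simp only: ell2_inner_add_left[OF R S S])
  moreover have "ell2_inner R S = 0"
    using assms(3) ell2_inner_commute[of R S] by simp
  ultimately show ?thesis
    using assms(3) by (simp add: ell2_inner_add_left[OF R S T])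
qed

subsection \<open>Power series on the bidisk\<close>

text \<open>Summation is unordered over index pairs, so expansions may be swapped and reindexed
  freely. Exhibiting one identifies Taylor coefficients without differentiating.\<close>

definition bidisk_expansion ::
  "(complex \<times> complex \<Rightarrow> complex) \<Rightarrow> (nat \<times> nat \<Rightarrow> complex) \<Rightarrow> bool" where
  "bidisk_expansion f c \<longleftrightarrow> (\<forall>z\<in>ball 0 1. \<forall>w\<in>ball 0 1.
     ((\<lambda>(i, j). c (i, j) * (z ^ i * w ^ j)) has_sum f (z, w)) UNIV)"

lemma has_sum_power_product:
  fixes z w :: complex
  assumes "cmod z < 1" "cmod w < 1"
  shows "((\<lambda>(i, j). z ^ i * w ^ j) has_sum 1 / ((1 - z) * (1 - w))) UNIV"
    and "(\<lambda>(i, j). cmod z ^ i * cmod w ^ j) summable_on UNIV"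
proof -
  have geo: "((\<lambda>i. a ^ i) has_sum 1 / (1 - a)) UNIV" if "norm a < 1"
    for a :: "'a::{real_normed_field,banach}"
    using geometric_sums[OF that] that
    by (intro norm_summable_imp_has_sum) (simp_all add: norm_power summable_geometric)
  have "(\<lambda>(i, j). cmod z ^ i * cmod w ^ j) summable_on Sigma UNIV (\<lambda>_. UNIV)"
  proof (rule summable_on_SigmaI)
    show "((\<lambda>j. case (i, j) of (i, j) \<Rightarrow> cmod z ^ i * cmod w ^ j) has_sum
        cmod z ^ i * (1 / (1 - cmod w))) UNIV" for i
      using assms has_sum_cmult_right[OF geo[of "cmod w"], of "cmod z ^ i"] by simp
    show "(\<lambda>i. cmod z ^ i * (1 / (1 - cmod w))) summable_on UNIV"
      using geo[of "cmod z"] assms by (intro summable_on_cmult_left) (auto simp: summable_on_def)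
  qed auto
  then show *: "(\<lambda>(i, j). cmod z ^ i * cmod w ^ j) summable_on UNIV" by simp
  have "((\<lambda>(i, j). z ^ i * w ^ j) has_sum 1 / ((1 - z) * (1 - w))) (Sigma UNIV (\<lambda>_. UNIV))"
  proof (rule has_sum_SigmaI)
    show "((\<lambda>j. case (i, j) of (i, j) \<Rightarrow> z ^ i * w ^ j) has_sum z ^ i * (1 / (1 - w))) UNIV" for i
      using assms has_sum_cmult_right[OF geo[of w], of "z ^ i"] by simp
    show "((\<lambda>i. z ^ i * (1 / (1 - w))) has_sum 1 / ((1 - z) * (1 - w))) UNIV"
      using has_sum_cmult_left[OF geo[of z], of "1 / (1 - w)"] assms by simp
    show "(\<lambda>(i, j). z ^ i * w ^ j) summable_on Sigma UNIV (\<lambda>_. UNIV)"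
      by (rule abs_summable_summable) (use * in \<open>simp add: case_prod_unfold norm_mult norm_power\<close>)
  qed
  then show "((\<lambda>(i, j). z ^ i * w ^ j) has_sum 1 / ((1 - z) * (1 - w))) UNIV" by simp
qed

lemma square_summable_power_product:
  fixes z w :: complex
  assumes "cmod z < 1" "cmod w < 1"
  shows "square_summable (\<lambda>(i, j). z ^ i * w ^ j)"
proof -
  have "(cmod z)\<^sup>2 < 1" "(cmod w)\<^sup>2 < 1"
    using assms by (simp_all add: power_less_one_iff)
  then show ?thesis
    using has_sum_power_product(2)[of "z\<^sup>2" "w\<^sup>2"]
    by (simp add: square_summable_def case_prod_unfold norm_mult norm_power power_mult_distrib
        flip: power_mult add: mult.commute)
qed

text \<open>Square summability upgrades the iterated power series to an unconditional double series.\<close>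

lemma bidisk_expansion_taylor_coeff:
  assumes "f \<in> hardy2"
  shows "bidisk_expansion f (taylor_coeff f)"
  unfolding bidisk_expansion_def
proof (intro ballI)
  fix z w :: complex assume z: "z \<in> ball 0 1" and w: "w \<in> ball 0 1"
  let ?a = "\<lambda>i j. taylor_coeff f (i, j) * (z ^ i * w ^ j)"
  have "square_summable (taylor_coeff f)" and f: "holomorphic_on_bidisk f"
    using assms by (auto simp: hardy2_def square_summable_def)
  \<comment> \<open>The product of two square-summable families is absolutely summable.\<close>
  from square_summable_mult[OF this(1) square_summable_power_product[of z w]]
  have sum: "(\<lambda>(i, j). ?a i j) summable_on UNIV"
    using z w by (simp add: case_prod_unfold)
  then obtain s where "((\<lambda>(i, j). ?a i j) has_sum s) (UNIV \<times> UNIV)"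
    by (auto simp: summable_on_def)
  \<comment> \<open>The outer index becomes the exponent of \<open>w\<close>, matching the order of
    the iterated expansion; the two limits can then be compared.\<close>
  then have s: "((\<lambda>(j, i). ?a i j) has_sum s) (UNIV \<times> UNIV)"
    by (subst (asm) has_sum_swap) (simp add: case_prod_unfold)
  obtain g where g: "\<And>j. (\<lambda>i. taylor_coeff f (i, j) * z ^ i) sums g j"
    and g': "(\<lambda>j. g j * w ^ j) sums f (z, w)"
    using taylor_iterated_sums[OF f z w] by metis
  have "((\<lambda>i. ?a i j) has_sum g j * w ^ j) UNIV" for j
  proof -
    have "(\<lambda>i. ?a i j) summable_on UNIV"
      using summable_on_SigmaD1[of "\<lambda>j i. ?a i j" UNIV "\<lambda>_. UNIV" j] s
      by (auto simp: summable_on_def)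
    then obtain t where t: "((\<lambda>i. ?a i j) has_sum t) UNIV"
      by (auto simp: summable_on_def)
    have "(\<lambda>i. ?a i j) sums (g j * w ^ j)"
      using sums_mult2[OF g[of j], of "w ^ j"] by (simp add: mult.assoc)
    then show ?thesis
      using t has_sum_imp_sums[OF t] sums_unique2 by blast
  qed
  then have "((\<lambda>j. g j * w ^ j) has_sum s) UNIV"
    using has_sum_SigmaD[OF s, of "\<lambda>j. g j * w ^ j"] by simp
  then have "s = f (z, w)"
    using has_sum_imp_sums g' sums_unique2 by blast
  then show "((\<lambda>(i, j). ?a i j) has_sum f (z, w)) UNIV"
    using \<open>((\<lambda>(i, j). ?a i j) has_sum s) (UNIV \<times> UNIV)\<close> by simp
qed

text \<open>Convergence at the single point 1/2 gives a positive radius of convergence, so the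
  formal power series has \<open>c\<close> as its Taylor coefficients and agrees with
  \<open>g\<close> near 0.\<close>

lemma higher_deriv_power_series:
  assumes "\<And>w. w \<in> ball 0 1 \<Longrightarrow> (\<lambda>n. c n * w ^ n) sums g w"
  shows "(deriv ^^ n) g (0::complex) = fact n * c n"
proof -
  let ?F = "Abs_fps c"
  have "summable (\<lambda>n. c n * (1/2) ^ n)"
    using assms[of "1/2"] by (auto simp: sums_iff)
  then have "ereal (norm (1/2::complex)) \<le> conv_radius c"
    by (rule conv_radius_geI)
  then have "fps_conv_radius ?F > 0"
    unfolding fps_conv_radius_def fps_nth_Abs_fps
    by (rule less_le_trans[rotated]) simp
  then have "c n = (deriv ^^ n) (eval_fps ?F) 0 / fact n"
    using fps_nth_conv_deriv[of ?F n] by simp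
  moreover have "(deriv ^^ n) (eval_fps ?F) 0 = (deriv ^^ n) g 0"
  proof (rule higher_deriv_cong_ev)
    have "eval_fps ?F w = g w" if "w \<in> ball 0 1" for w
      using assms[OF that] by (simp add: eval_fps_def sums_iff)
    then show "\<forall>\<^sub>F w in nhds 0. eval_fps ?F w = g w"
      unfolding eventually_nhds by (intro exI[of _ "ball 0 1"]) auto
  qed auto
  ultimately show ?thesis by simp
qed

text \<open>Uniqueness of the expansion: summing over \<open>i\<close> first gives a power series in
  \<open>w\<close> whose coefficients are power series in \<open>z\<close>, and differentiating in
  \<open>w\<close>, then in \<open>z\<close>, isolates \<open>c (i, j)\<close>.\<close>

lemma taylor_coeff_eqI:
  assumes "bidisk_expansion f c"
  shows "taylor_coeff f = c"
proof -
  define g where "g j z = (\<Sum>i. c (i, j) * z ^ i)" for j z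
  have sum: "((\<lambda>(j, i). c (i, j) * (z ^ i * w ^ j)) has_sum f (z, w)) (UNIV \<times> UNIV)"
    if "z \<in> ball 0 1" "w \<in> ball 0 1" for z w
  proof -
    have "((\<lambda>(i, j). c (i, j) * (z ^ i * w ^ j)) has_sum f (z, w)) (UNIV \<times> UNIV)"
      using that assms unfolding bidisk_expansion_def UNIV_Times_UNIV by blast
    then show ?thesis
      by (subst has_sum_swap) (simp add: case_prod_unfold)
  qed
  have inner: "((\<lambda>i. c (i, j) * z ^ i) has_sum g j z) UNIV" if z: "z \<in> ball 0 1" for z j
  proof -
    \<comment> \<open>Any nonzero \<open>w\<close> in the disk would do: its power is a constant
      factor that can be cancelled.\<close>
    have "(\<lambda>i. c (i, j) * (z ^ i * (1/2) ^ j)) summable_on UNIV"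
      using summable_on_SigmaD1[of "\<lambda>j i. c (i, j) * (z ^ i * (1/2) ^ j)" UNIV "\<lambda>_. UNIV" j]
        sum[OF z, of "1/2"] by (auto simp: summable_on_def)
    then have "(\<lambda>i. c (i, j) * z ^ i * (1/2) ^ j) summable_on UNIV"
      by (simp only: mult.assoc)
    then have "(\<lambda>i. c (i, j) * z ^ i) summable_on UNIV"
      by (subst (asm) summable_on_cmult_left') simp_all
    then show ?thesis
      unfolding g_def by (metis has_sum_imp_sums has_sum_infsum sums_unique)
  qed
  have "(\<lambda>j. g j z * w ^ j) sums f (z, w)" if z: "z \<in> ball 0 1" and w: "w \<in> ball 0 1" for z w
  proof -
    have "((\<lambda>i. c (i, j) * (z ^ i * w ^ j)) has_sum g j z * w ^ j) UNIV" for j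
      using has_sum_cmult_left[OF inner[OF z, of j], of "w ^ j"] by (simp only: mult.assoc)
    then have "((\<lambda>j. g j z * w ^ j) has_sum f (z, w)) UNIV"
      using has_sum_SigmaD[OF sum[OF z w], of "\<lambda>j. g j z * w ^ j"] by simp
    then show ?thesis by (rule has_sum_imp_sums)
  qed
  then have "(deriv ^^ j) (\<lambda>w. f (z, w)) 0 = fact j * g j z" if "z \<in> ball 0 1" for z j
    using that by (intro higher_deriv_power_series)
  then have "(\<lambda>i. (fact j * c (i, j)) * z ^ i) sums (deriv ^^ j) (\<lambda>w. f (z, w)) 0"
    if "z \<in> ball 0 1" for z j
    using that sums_mult[OF has_sum_imp_sums[OF inner[OF that, of j]], of "fact j"]
    by (simp add: mult.assoc)
  then have "(deriv ^^ i) (\<lambda>z. (deriv ^^ j) (\<lambda>w. f (z, w)) 0) 0 = fact i * (fact j * c (i, j))" for i j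
    by (rule higher_deriv_power_series)
  then show ?thesis
    by (auto simp: taylor_coeff_def)
qed

lemma has_sum_sum:
  fixes F :: "'k \<Rightarrow> 'a \<Rightarrow> 'b::topological_comm_monoid_add"
  assumes "\<And>k. k \<in> K \<Longrightarrow> (F k has_sum s k) A"
  shows "((\<lambda>x. \<Sum>k\<in>K. F k x) has_sum (\<Sum>k\<in>K. s k)) A"
  using assms by (induction K rule: infinite_finite_induct) (simp_all add: has_sum_add)

lemma bidisk_expansion_sum:
  assumes "\<And>k. k \<in> K \<Longrightarrow> bidisk_expansion (F k) (C k)"
  shows "bidisk_expansion (\<lambda>x. \<Sum>k\<in>K. d k * F k x) (\<lambda>ij. \<Sum>k\<in>K. d k * C k ij)"
  unfolding bidisk_expansion_def
proof (intro ballI)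
  fix z w :: complex assume "z \<in> ball 0 1" "w \<in> ball 0 1"
  then have "((\<lambda>ij. \<Sum>k\<in>K. d k * (case ij of (i, j) \<Rightarrow> C k (i, j) * (z ^ i * w ^ j)))
      has_sum (\<Sum>k\<in>K. d k * F k (z, w))) UNIV"
    using assms unfolding bidisk_expansion_def by (intro has_sum_sum has_sum_cmult_right) auto
  then show "((\<lambda>(i, j). (\<Sum>k\<in>K. d k * C k (i, j)) * (z ^ i * w ^ j))
      has_sum (\<Sum>k\<in>K. d k * F k (z, w))) UNIV"
    by (simp add: case_prod_unfold sum_distrib_right mult.assoc)
qed

lemma bidisk_expansion_diff:
  assumes "bidisk_expansion f a" "bidisk_expansion g b"
  shows "bidisk_expansion (\<lambda>x. f x - g x) (\<lambda>ij. a ij - b ij)"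
  using bidisk_expansion_sum[of "{True, False}" "\<lambda>k. if k then f else g" "\<lambda>k. if k then a else b"
      "\<lambda>k. if k then 1 else - 1"] assms by simp

text \<open>The coefficient family after multiplication by the \<open>k\<close>-th monomial. As in
  \<open>deglex_monom\<close>, the first decoded component \<open>q\<close> is the exponent of
  \<open>w\<close>.\<close>

definition coeff_shift :: "nat \<Rightarrow> (nat \<times> nat \<Rightarrow> complex) \<Rightarrow> nat \<times> nat \<Rightarrow> complex" where
  "coeff_shift k a = (\<lambda>(i, j). case prod_decode k of (q, p) \<Rightarrow>
     if p \<le> i \<and> q \<le> j then a (i - p, j - q) else 0)"

text \<open>Outside \<open>{p..} \<times> {q..}\<close> the shifted family vanishes and so does
  \<open>F\<close>; on it, subtracting \<open>(p, q)\<close> is a bijection. A general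
  \<open>F\<close> serves both power series terms and squared moduli.\<close>

lemma coeff_shift_reindex:
  fixes F :: "complex \<Rightarrow> nat \<Rightarrow> nat \<Rightarrow> 'b::{comm_monoid_add, topological_space}"
  assumes "prod_decode k = (q, p)" and "\<And>i j. F 0 i j = 0"
  shows "((\<lambda>(i, j). F (coeff_shift k a (i, j)) i j) has_sum s) UNIV \<longleftrightarrow>
    ((\<lambda>(i, j). F (a (i, j)) (i + p) (j + q)) has_sum s) UNIV"
proof -
  have "((\<lambda>(i, j). F (coeff_shift k a (i, j)) i j) has_sum s) UNIV \<longleftrightarrow>
      ((\<lambda>(i, j). F (coeff_shift k a (i, j)) i j) has_sum s) ({p..} \<times> {q..})"
    using assms(2) by (intro has_sum_cong_neutral) (auto simp: coeff_shift_def assms(1) split: if_splits)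
  also have "\<dots> \<longleftrightarrow> ((\<lambda>(i, j). F (a (i, j)) (i + p) (j + q)) has_sum s) UNIV"
    by (rule has_sum_reindex_bij_witness[where i = "\<lambda>(i, j). (i + p, j + q)" and j = "\<lambda>(i, j). (i - p, j - q)"])
      (auto simp: coeff_shift_def assms(1))
  finally show ?thesis .
qed

lemma bidisk_expansion_monom_mult:
  assumes "bidisk_expansion f a"
  shows "bidisk_expansion (\<lambda>x. deglex_monom k x * f x) (coeff_shift k a)"
  unfolding bidisk_expansion_def
proof (intro ballI)
  fix z w :: complex assume "z \<in> ball 0 1" "w \<in> ball 0 1"
  then have s: "((\<lambda>(i, j). a (i, j) * (z ^ i * w ^ j)) has_sum f (z, w)) UNIV"
    using assms by (auto simp: bidisk_expansion_def)
  obtain q p where k: "prod_decode k = (q, p)" by fastforce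
  have "((\<lambda>(i, j). a (i, j) * (z ^ (i + p) * w ^ (j + q))) has_sum (z ^ p * w ^ q) * f (z, w)) UNIV"
    using has_sum_cmult_right[OF s, of "z ^ p * w ^ q"] by (simp add: case_prod_unfold power_add mult_ac)
  then show "((\<lambda>(i, j). coeff_shift k a (i, j) * (z ^ i * w ^ j)) has_sum
      deglex_monom k (z, w) * f (z, w)) UNIV"
    by (subst coeff_shift_reindex[OF k, of "\<lambda>x i j. x * (z ^ i * w ^ j)"])
      (simp_all add: deglex_monom_def k)
qed

lemma square_summable_coeff_shift:
  assumes "square_summable a"
  shows "square_summable (coeff_shift k a)"
proof -
  obtain q p where k: "prod_decode k = (q, p)" by fastforce
  show ?thesis
    using assms coeff_shift_reindex[OF k, of "\<lambda>x i j. (cmod x)\<^sup>2" a]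
    by (simp add: square_summable_def summable_on_def case_prod_unfold)
qed

lemma bidisk_expansion_szego_kernel:
  assumes "\<alpha> \<in> bidisk"
  shows "bidisk_expansion (szego_kernel \<alpha>) (\<lambda>(i, j). cnj (fst \<alpha>) ^ i * cnj (snd \<alpha>) ^ j)"
  unfolding bidisk_expansion_def
proof (intro ballI)
  fix z w :: complex assume "z \<in> ball 0 1" "w \<in> ball 0 1"
  then have "cmod (cnj (fst \<alpha>) * z) < 1" "cmod (cnj (snd \<alpha>) * w) < 1"
    using assms mult_strict_mono'[of "cmod (fst \<alpha>)" 1 "cmod z" 1] mult_strict_mono'[of "cmod (snd \<alpha>)" 1 "cmod w" 1]
    by (auto simp: bidisk_def norm_mult)
  from has_sum_power_product(1)[OF this]
  show "((\<lambda>(i, j). (case (i, j) of (i, j) \<Rightarrow> cnj (fst \<alpha>) ^ i * cnj (snd \<alpha>) ^ j) * (z ^ i * w ^ j))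
      has_sum szego_kernel \<alpha> (z, w)) UNIV"
    by (simp add: szego_kernel_def power_mult_distrib case_prod_unfold mult_ac)
qed

text \<open>The reproducing property. With the kernel in the first argument, the sum is the
  conjugate of the expansion of \<open>g\<close> at \<open>\<alpha>\<close>.\<close>

lemma hardy_inner_szego_kernel:
  assumes \<alpha>: "\<alpha> \<in> bidisk" and g: "bidisk_expansion g a"
  shows "hardy_inner (szego_kernel \<alpha>) g = cnj (g \<alpha>)"
proof -
  have "((\<lambda>(i, j). a (i, j) * (fst \<alpha> ^ i * snd \<alpha> ^ j)) has_sum g \<alpha>) UNIV"
    using \<alpha> g unfolding bidisk_expansion_def bidisk_def by (cases \<alpha>) auto
  then have "(\<Sum>\<^sub>\<infinity>(i, j)\<in>UNIV. cnj (a (i, j) * (fst \<alpha> ^ i * snd \<alpha> ^ j))) = cnj (g \<alpha>)"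
    by (simp only: case_prod_unfold infsum_cnj) (simp add: infsumI case_prod_unfold)
  then show ?thesis
    unfolding hardy_inner_def taylor_coeff_eqI[OF g]
      taylor_coeff_eqI[OF bidisk_expansion_szego_kernel[OF \<alpha>]]
    by (simp add: case_prod_unfold mult_ac)
qed

lemma bidisk_expansion_one: "bidisk_expansion (\<lambda>_. 1) (\<lambda>ij. if ij = (0, 0) then 1 else 0)"
  unfolding bidisk_expansion_def
  by (intro ballI has_sum_finite_neutralI[of "{(0, 0)}"]) (auto split: if_splits)

subsection \<open>Optimal polynomial approximants\<close>

text \<open>The system is triangular: at the exponents of the \<open>k\<close>-th monomial, later
  shifts vanish, earlier ones have \<open>d m = 0\<close> by induction, and the \<open>k\<close>-th
  contributes \<open>a (0, 0)\<close>.\<close>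

lemma coeff_shift_independent:
  assumes a: "a (0, 0) \<noteq> 0" and sum: "\<And>ij. (\<Sum>k\<le>n. d k * coeff_shift k a ij) = 0" and "k \<le> n"
  shows "d k = 0"
  using \<open>k \<le> n\<close>
proof (induction k rule: less_induct)
  case (less k)
  obtain q p where k: "prod_decode k = (q, p)" by fastforce
  have "d m * coeff_shift m a (p, q) = (if m = k then d k * a (0, 0) else 0)" if "m \<le> n" for m
  proof (cases m k rule: linorder_cases)
    case greater
    obtain q' p' where m: "prod_decode m = (q', p')" by fastforce
    \<comment> \<open>A monomial that divides another does not come after it in degree lexicographic
      order.\<close>
    have "\<not> (p' \<le> p \<and> q' \<le> q)"
    proof
      assume le: "p' \<le> p \<and> q' \<le> q"
      then have "triangle (q' + p') \<le> triangle (q + p)"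
        unfolding triangle_def by (intro div_le_mono mult_le_mono) auto
      then have "prod_encode (q', p') \<le> prod_encode (q, p)"
        using le by (simp add: prod_encode_def)
      then have "m \<le> k"
        using prod_decode_inverse[of m] prod_decode_inverse[of k] by (simp add: k m)
      then show False using greater by simp
    qed
    then show ?thesis using greater by (auto simp: coeff_shift_def m)
  qed (use less that in \<open>auto simp: coeff_shift_def k\<close>)
  then have "(\<Sum>m\<le>n. d m * coeff_shift m a (p, q)) = d k * a (0, 0)"
    using less.prems by simp
  then show ?case using sum[of "(p, q)"] a by simp
qed

section \<open>Linear algebra: invertibility and null vectors\<close>

lemma invertible_mat_iff_det:
  fixes A :: "'a::field mat"
  assumes A: "A \<in> carrier_mat m m"
  shows "invertible_mat A \<longleftrightarrow> det A \<noteq> 0"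
proof
  assume "invertible_mat A"
  then obtain B where AB: "A * B = 1\<^sub>m (dim_row A)" and BA: "B * A = 1\<^sub>m (dim_row B)"
    by (auto simp: invertible_mat_def inverts_mat_def)
  \<comment> \<open>The shape of \<open>B\<close> is not part of invertibility; comparing column
    counts in both products recovers it.\<close>
  have "dim_col B = m" "dim_row B = m"
    using arg_cong[OF AB, of dim_col] arg_cong[OF BA, of dim_col] A by auto
  then have B: "B \<in> carrier_mat m m" by auto
  have "det A * det B = 1"
    using det_mult[OF A B] AB A by simp
  then show "det A \<noteq> 0" by auto
next
  assume "det A \<noteq> 0"
  then obtain B where "B \<in> carrier_mat m m" "B * A = 1\<^sub>m m" "A * B = 1\<^sub>m m"
    using det_non_zero_imp_unit[OF A, of "()"] by (auto simp: Units_def ring_mat_def)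
  then show "invertible_mat A"
    using A by (auto simp: invertible_mat_def inverts_mat_def)
qed

text \<open>Replaces matrices and vectors by plain finite sums, in which the later arguments are
  phrased.\<close>

lemma invertible_mat_iff_kernel:
  fixes F :: "nat \<Rightarrow> nat \<Rightarrow> 'a::field"
  shows "invertible_mat (mat (n + 1) (n + 1) (\<lambda>(i, j). F i j)) \<longleftrightarrow>
    (\<forall>x. (\<forall>i\<le>n. (\<Sum>j\<le>n. F i j * x j) = 0) \<longrightarrow> (\<forall>j\<le>n. x j = 0))"
proof -
  let ?A = "mat (n + 1) (n + 1) (\<lambda>(i, j). F i j)"
  have mult: "(?A *\<^sub>v vec (n + 1) x) = 0\<^sub>v (n + 1) \<longleftrightarrow> (\<forall>i\<le>n. (\<Sum>j\<le>n. F i j * x j) = 0)" for x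
    by (auto simp: vec_eq_iff scalar_prod_def less_Suc_eq_le atLeast0LessThan lessThan_Suc_atMost)
  have zero: "vec (n + 1) x = 0\<^sub>v (n + 1) \<longleftrightarrow> (\<forall>j\<le>n. x j = 0)" for x :: "nat \<Rightarrow> 'a"
    by (auto simp: vec_eq_iff less_Suc_eq_le)
  have "invertible_mat ?A \<longleftrightarrow> \<not> (\<exists>v. v \<in> carrier_vec (n + 1) \<and> v \<noteq> 0\<^sub>v (n + 1) \<and> ?A *\<^sub>v v = 0\<^sub>v (n + 1))"
    by (subst invertible_mat_iff_det[of _ "n + 1"], simp) (subst det_0_iff_vec_prod_zero_field[of _ "n + 1"], auto)
  also have "\<dots> \<longleftrightarrow> (\<forall>x. ?A *\<^sub>v vec (n + 1) x = 0\<^sub>v (n + 1) \<longrightarrow> vec (n + 1) x = 0\<^sub>v (n + 1))"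
    by (metis carrier_vecD dim_vec eq_vecI index_vec vec_carrier)
  finally show ?thesis
    unfolding mult zero .
qed

lemma invertible_mat_transpose_iff:
  fixes F :: "nat \<Rightarrow> nat \<Rightarrow> 'a::field"
  shows "invertible_mat (mat m m (\<lambda>(i, j). F i j)) \<longleftrightarrow> invertible_mat (mat m m (\<lambda>(i, j). F j i))"
proof -
  have "transpose_mat (mat m m (\<lambda>(i, j). F i j)) = mat m m (\<lambda>(i, j). F j i)"
    by auto
  then show ?thesis
    by (metis det_transpose invertible_mat_iff_det mat_carrier)
qed

text \<open>An injective square system has an invertible matrix; the solution is the inverse applied
  to the right-hand side.\<close>

lemma linear_system_solvable:
  fixes F :: "nat \<Rightarrow> nat \<Rightarrow> 'a::field"
  assumes "\<And>x. (\<forall>i\<le>n. (\<Sum>j\<le>n. F i j * x j) = 0) \<Longrightarrow> (\<forall>j\<le>n. x j = 0)"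
  obtains c where "\<And>i. i \<le> n \<Longrightarrow> (\<Sum>j\<le>n. F i j * c j) = b i"
proof -
  let ?A = "mat (n + 1) (n + 1) (\<lambda>(i, j). F i j)"
  have "invertible_mat ?A"
    using assms by (subst invertible_mat_iff_kernel) blast
  then obtain B where AB: "?A * B = 1\<^sub>m (n + 1)" and BA: "B * ?A = 1\<^sub>m (dim_row B)"
    by (auto simp: invertible_mat_def inverts_mat_def)
  have "dim_col B = n + 1" "dim_row B = n + 1"
    using arg_cong[OF AB, of dim_col] arg_cong[OF BA, of dim_col] by auto
  then have B: "B \<in> carrier_mat (n + 1) (n + 1)" by auto
  define v where "v = B *\<^sub>v vec (n + 1) b"
  have v: "v \<in> carrier_vec (n + 1)" using B by (simp add: v_def)
  have "?A *\<^sub>v v = vec (n + 1) b"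
    unfolding v_def using B AB by (subst assoc_mult_mat_vec[symmetric, of _ "n + 1" "n + 1" _ "n + 1"]) auto
  then have Av: "vec_index (?A *\<^sub>v v) i = b i" if "i \<le> n" for i
    using that by simp
  have "(\<Sum>j\<le>n. F i j * vec_index v j) = b i" if "i \<le> n" for i
    using Av[OF that] that carrier_vecD[OF v]
    by (simp add: scalar_prod_def less_Suc_eq_le atLeast0LessThan lessThan_Suc_atMost del: sum.lessThan_Suc)
  then show ?thesis using that by blast
qed

text \<open>
  Since \<open>coeff_shift k (taylor_coeff f)\<close> is the coefficient sequence of \<open>\<chi>\<^sub>k f\<close>, the second
  conclusion says that the residual \<open>p f - 1\<close> is orthogonal to every \<open>\<chi>\<^sub>j f\<close>. In the third one the
  Gram matrix is the transpose of the one in \<^const>\<open>opa_matrix\<close>.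
\<close>

lemma opa_normal_equations:
  fixes f n
  defines "u \<equiv> \<lambda>k. coeff_shift k (taylor_coeff f)"
  assumes f: "f \<in> hardy2" and f0: "f (0, 0) \<noteq> 0"
  obtains c where "opa n f = (\<lambda>x. \<Sum>k\<le>n. c k * deglex_monom k x)"
    and "\<And>j. j \<le> n \<Longrightarrow>
      (\<Sum>k\<le>n. c k * ell2_inner (u k) (u j)) = (if j = 0 then cnj (f (0, 0)) else 0)"
    and "\<And>x. (\<forall>i\<le>n. (\<Sum>k\<le>n. ell2_inner (u k) (u i) * x k) = 0) \<Longrightarrow> (\<forall>k\<le>n. x k = 0)"
proof -
  let ?a = "taylor_coeff f"
  \<comment> \<open>Coefficients of the constant 1; below, \<open>L d\<close> holds those of
    \<open>P d\<close> times \<open>f\<close>.\<close>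
  define e :: "nat \<times> nat \<Rightarrow> complex" where "e = (\<lambda>ij. if ij = (0, 0) then 1 else 0)"
  define P where "P d = (\<lambda>x. \<Sum>k\<le>n. d k * deglex_monom k x)" for d :: "nat \<Rightarrow> complex"
  define L where "L d = (\<lambda>ij. \<Sum>k\<le>n. d k * u k ij)" for d :: "nat \<Rightarrow> complex"
  have a: "square_summable ?a" using f by (simp add: hardy2_def square_summable_def)
  have u: "square_summable (u k)" for k
    unfolding u_def by (rule square_summable_coeff_shift[OF a])
  have L: "square_summable (L d)" for d
    unfolding L_def by (intro square_summable_sum u)
  have e: "square_summable e"
    unfolding square_summable_def e_def
    by (rule finite_nonzero_values_imp_summable_on, rule finite_subset[of _ "{(0, 0)}"]) (auto split: if_splits)
  have fexp: "bidisk_expansion f ?a" by (rule bidisk_expansion_taylor_coeff[OF f])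
  \<comment> \<open>At the origin only the constant term survives, because
    \<open>0 ^ 0 = 1\<close>.\<close>
  have "((\<lambda>(i, j). ?a (i, j) * (0 ^ i * 0 ^ j)) has_sum f (0, 0)) UNIV"
    using fexp by (auto simp: bidisk_expansion_def)
  moreover have "((\<lambda>(i, j). ?a (i, j) * (0 ^ i * 0 ^ j)) has_sum ?a (0, 0)) UNIV"
    by (rule has_sum_finite_neutralI[of "{(0, 0)}"]) (auto simp: power_0_left split: if_splits)
  ultimately have a0: "?a (0, 0) = f (0, 0)" by (rule has_sum_unique[rotated])
  have inner_e: "ell2_inner e (u j) = (if j = 0 then cnj (f (0, 0)) else 0)" for j
  proof -
    have "ell2_inner e (u j) = cnj (u j (0, 0))"
      unfolding ell2_inner_def e_def
      by (rule infsumI, rule has_sum_finite_neutralI[of "{(0, 0)}"]) (auto split: if_splits)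
    moreover have "prod_decode j = (0, 0) \<longleftrightarrow> j = 0"
      using prod_decode_eq[of j 0] by (simp add: prod_decode_def prod_decode_aux.simps)
    ultimately show ?thesis
      by (auto simp: u_def coeff_shift_def a0 split: prod.splits)
  qed
  have inner_L: "ell2_inner (L d) B = (\<Sum>k\<le>n. d k * ell2_inner (u k) B)" if "square_summable B" for d B
    unfolding L_def by (intro ell2_inner_sum_left u that)
  have L_0: "\<forall>k\<le>n. d k = 0" if "Re (ell2_inner (L d) (L d)) \<le> 0" for d
  proof (intro allI impI)
    fix k assume k: "k \<le> n"
    have "L d ij = 0" for ij by (rule ell2_inner_self_eq_0D[OF L that])
    then show "d k = 0"
      using coeff_shift_independent[where a = ?a and n = n and d = d and k = k] f0 a0 k by (simp add: L_def u_def)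
  qed
  have orth: "ell2_inner (L d) B = 0"
    if "\<And>k. k \<le> n \<Longrightarrow> ell2_inner B (u k) = 0" "square_summable B" for d B
    unfolding inner_L[OF that(2)] using that(1) ell2_inner_commute[of _ B] by simp
  \<comment> \<open>A null vector makes \<open>L x\<close> orthogonal to every \<open>u i\<close>,
    hence to itself.\<close>
  have nonsing: "\<forall>k\<le>n. x k = 0" if "\<forall>i\<le>n. (\<Sum>k\<le>n. ell2_inner (u k) (u i) * x k) = 0" for x
  proof (rule L_0)
    have "ell2_inner (L x) (u i) = 0" if "i \<le> n" for i
      using that \<open>\<forall>i\<le>n. _ i = 0\<close> by (simp add: inner_L[OF u] mult.commute)
    then show "Re (ell2_inner (L x) (L x)) \<le> 0"
      using orth[OF _ L] by simp
  qed
  obtain c where c: "\<And>i. i \<le> n \<Longrightarrow> (\<Sum>k\<le>n. ell2_inner (u k) (u i) * c k) = ell2_inner e (u i)"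
    using linear_system_solvable[of n "\<lambda>i k. ell2_inner (u k) (u i)" "\<lambda>i. ell2_inner e (u i)"] nonsing
    by blast
  define R where "R d = (\<lambda>ij. L d ij - e ij)" for d
  have R: "square_summable (R d)" for d
    unfolding R_def by (intro square_summable_diff L e)
  have norm: "hardy_norm (\<lambda>x. P d x * f x - 1) = sqrt (Re (ell2_inner (R d) (R d)))" for d
  proof -
    have "bidisk_expansion (\<lambda>x. (\<Sum>k\<le>n. d k * (deglex_monom k x * f x)) - 1) (R d)"
      unfolding R_def L_def u_def e_def
      by (intro bidisk_expansion_diff bidisk_expansion_sum bidisk_expansion_monom_mult fexp bidisk_expansion_one)
    then have "taylor_coeff (\<lambda>x. P d x * f x - 1) = R d"
      by (intro taylor_coeff_eqI) (simp add: P_def sum_distrib_right mult.assoc)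
    then show ?thesis
      by (simp add: hardy_norm_def hardy_inner_eq_ell2_inner)
  qed
  have R_orth: "ell2_inner (R c) (u i) = 0" if "i \<le> n" for i
    using c[OF that] by (simp add: R_def ell2_inner_diff_left[OF L e u] inner_L[OF u] mult.commute)
  \<comment> \<open>Pythagoras, as the residual \<open>R c\<close> is orthogonal to every
    \<open>L d\<close>. This gives both minimality of \<open>P c\<close> and, through
    \<open>L_0\<close>, its uniqueness.\<close>
  have split: "Re (ell2_inner (R d) (R d)) =
      Re (ell2_inner (R c) (R c)) + Re (ell2_inner (L (\<lambda>k. d k - c k)) (L (\<lambda>k. d k - c k)))" for d
  proof -
    have "R d = (\<lambda>ij. R c ij + L (\<lambda>k. d k - c k) ij)"
      by (simp add: R_def L_def fun_eq_iff sum_subtractf left_diff_distrib)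
    then show ?thesis
      by (simp only: ell2_pythagoras[OF R L orth[OF R_orth R]])
  qed
  have L_nonneg: "Re (ell2_inner (L d) (L d)) \<ge> 0" for d
  proof (rule ccontr)
    assume neg: "\<not> Re (ell2_inner (L d) (L d)) \<ge> 0"
    then have "L d ij = 0" for ij
      by (intro ell2_inner_self_eq_0D[OF L]) simp
    then have "ell2_inner (L d) (L d) = 0" by (simp add: ell2_inner_def)
    then show False using neg by simp
  qed
  have polys: "deglex_polys n = range P"
    by (auto simp: deglex_polys_def P_def)
  have min: "hardy_norm (\<lambda>x. P c x * f x - 1) \<le> hardy_norm (\<lambda>x. P d x * f x - 1)" for d
    unfolding norm using split[of d] L_nonneg[of "\<lambda>k. d k - c k"] by simp
  have "opa n f = P c"
    unfolding opa_def
  proof (rule the_equality)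
    show "P c \<in> deglex_polys n \<and> (\<forall>q\<in>deglex_polys n.
        hardy_norm (\<lambda>x. P c x * f x - 1) \<le> hardy_norm (\<lambda>x. q x * f x - 1))"
      using min by (auto simp: polys)
    fix p assume p: "p \<in> deglex_polys n \<and> (\<forall>q\<in>deglex_polys n.
        hardy_norm (\<lambda>x. p x * f x - 1) \<le> hardy_norm (\<lambda>x. q x * f x - 1))"
    then obtain d where d: "p = P d" by (auto simp: polys)
    have "hardy_norm (\<lambda>x. P d x * f x - 1) \<le> hardy_norm (\<lambda>x. P c x * f x - 1)"
      using p unfolding d polys by blast
    then have "Re (ell2_inner (L (\<lambda>k. d k - c k)) (L (\<lambda>k. d k - c k))) \<le> 0"
      using split[of d] by (simp add: norm)
    from L_0[OF this] show "p = P c"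
      unfolding d P_def by (intro ext sum.cong) auto
  qed
  then show ?thesis
    using that[of c] c nonsing inner_e unfolding P_def by (simp add: mult.commute)
qed

lemma cnj_deglex_monom: "cnj (deglex_monom k x) = deglex_monom k (cnj (fst x), cnj (snd x))"
  by (simp add: deglex_monom_def case_prod_unfold)

text \<open>The pointwise form of the theorem. The conjugate point arises because the first column
  holds conjugates of values at \<open>\<alpha>\<close>.\<close>

lemma invertible_opa_matrix_iff:
  assumes f: "f \<in> hardy2" and nz: "\<forall>x\<in>bidisk. f x \<noteq> 0" and \<alpha>: "\<alpha> \<in> bidisk"
  shows "invertible_mat (opa_matrix n f \<alpha>) \<longleftrightarrow> opa n f (cnj (fst \<alpha>), cnj (snd \<alpha>)) \<noteq> 0"
proof -
  define u where "u k = coeff_shift k (taylor_coeff f)" for k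
  have f0: "f (0, 0) \<noteq> 0" using nz by (simp add: bidisk_def)
  obtain c where c: "opa n f = (\<lambda>x. \<Sum>k\<le>n. c k * deglex_monom k x)"
    and normal: "\<And>j. j \<le> n \<Longrightarrow>
      (\<Sum>k\<le>n. c k * ell2_inner (u k) (u j)) = (if j = 0 then cnj (f (0, 0)) else 0)"
    and nonsing: "\<And>x. (\<forall>i\<le>n. (\<Sum>k\<le>n. ell2_inner (u k) (u i) * x k) = 0) \<Longrightarrow> (\<forall>k\<le>n. x k = 0)"
    by (rule opa_normal_equations[OF f f0, of n, folded u_def]) (rule that)
  define F where "F i j = (if j = 0 then cnj (deglex_monom i \<alpha> * f \<alpha>) else ell2_inner (u i) (u j))" for i j
  define s where "s = opa n f (cnj (fst \<alpha>), cnj (snd \<alpha>)) * cnj (f \<alpha>)"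
  have uexp: "bidisk_expansion (\<lambda>x. deglex_monom k x * f x) (u k)" for k
    unfolding u_def by (intro bidisk_expansion_monom_mult bidisk_expansion_taylor_coeff f)
  have M: "opa_matrix n f \<alpha> = mat (n + 1) (n + 1) (\<lambda>(i, j). F i j)"
    unfolding opa_matrix_def F_def hardy_inner_szego_kernel[OF \<alpha> uexp]
    unfolding hardy_inner_eq_ell2_inner taylor_coeff_eqI[OF uexp] by (rule refl)
  \<comment> \<open>The column \<open>j = 0\<close> evaluates the approximant at the conjugate
    point; the others are the normal equations with right-hand side 0.\<close>
  have cF: "(\<Sum>i\<le>n. c i * F i j) = (if j = 0 then s else 0)" if "j \<le> n" for j
    using normal[OF that] by (simp add: F_def s_def c cnj_deglex_monom sum_distrib_right mult.assoc)
  have s0: "s \<noteq> 0 \<longleftrightarrow> opa n f (cnj (fst \<alpha>), cnj (snd \<alpha>)) \<noteq> 0"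
    using nz \<alpha> by (simp add: s_def)
  show ?thesis
    unfolding M s0[symmetric]
  proof
    assume "invertible_mat (mat (n + 1) (n + 1) (\<lambda>(i, j). F i j))"
    then have inv: "\<And>x. (\<forall>j\<le>n. (\<Sum>i\<le>n. F i j * x i) = 0) \<Longrightarrow> (\<forall>i\<le>n. x i = 0)"
      using invertible_mat_iff_kernel[of n "\<lambda>i j. F j i"] by (subst (asm) invertible_mat_transpose_iff) blast
    show "s \<noteq> 0"
    proof
      assume "s = 0"
      then have "\<forall>i\<le>n. c i = 0"
        using inv[of c] cF by (simp add: mult.commute)
      \<comment> \<open>With \<open>c = 0\<close> the normal equation for \<open>j = 0\<close> would
        force \<open>f (0, 0) = 0\<close>.\<close>
      then show False using normal[of 0] f0 by simp
    qed
  next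
    assume s: "s \<noteq> 0"
    have "\<forall>j\<le>n. x j = 0" if x: "\<forall>i\<le>n. (\<Sum>j\<le>n. F i j * x j) = 0" for x
    proof -
      \<comment> \<open>The double sum is computed twice: by rows it is 0 since \<open>x\<close> is
        a null vector, by columns it is \<open>s * x 0\<close>.\<close>
      have "(\<Sum>j\<le>n. (\<Sum>i\<le>n. c i * F i j) * x j) = (\<Sum>i\<le>n. \<Sum>j\<le>n. c i * F i j * x j)"
        unfolding sum_distrib_right by (rule sum.swap)
      also have "\<dots> = (\<Sum>i\<le>n. c i * (\<Sum>j\<le>n. F i j * x j))"
        by (simp only: sum_distrib_left mult.assoc)
      also have "\<dots> = 0" using x by simp
      also have "(\<Sum>j\<le>n. (\<Sum>i\<le>n. c i * F i j) * x j) = (\<Sum>j\<le>n. if j = 0 then s * x 0 else 0)"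
        by (intro sum.cong) (auto simp: cF)
      finally have x0: "x 0 = 0" using s by simp
      \<comment> \<open>Since \<open>x 0 = 0\<close>, the first column may be replaced by the Gram
        column; conjugation then gives the transposed Gram matrix of \<open>nonsing\<close>.\<close>
      have "\<forall>k\<le>n. cnj (x k) = 0"
      proof (rule nonsing, intro allI impI)
        fix i assume "i \<le> n"
        have "(\<Sum>k\<le>n. ell2_inner (u k) (u i) * cnj (x k)) = cnj (\<Sum>k\<le>n. F i k * x k)"
          unfolding cnj_sum by (intro sum.cong) (auto simp: F_def x0 ell2_inner_commute[of _ "u i"])
        then show "(\<Sum>k\<le>n. ell2_inner (u k) (u i) * cnj (x k)) = 0"
          using x \<open>i \<le> n\<close> by simp
      qed
      then show ?thesis by simp
    qed
    then show "invertible_mat (mat (n + 1) (n + 1) (\<lambda>(i, j). F i j))"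
      by (subst invertible_mat_iff_kernel) blast
  qed
qed

theorem theorem4p4:
  fixes f :: "complex \<times> complex \<Rightarrow> complex" and n :: nat
  assumes "f \<in> hardy2"
    and "\<forall>x\<in>bidisk. f x \<noteq> 0"
  shows "(\<forall>x\<in>bidisk. opa n f x \<noteq> 0) \<longleftrightarrow>
         (\<forall>\<alpha>\<in>bidisk. invertible_mat (opa_matrix n f \<alpha>))"
proof -
  have "(\<forall>x\<in>bidisk. opa n f x \<noteq> 0) \<longleftrightarrow>
      (\<forall>\<alpha>\<in>bidisk. opa n f (cnj (fst \<alpha>), cnj (snd \<alpha>)) \<noteq> 0)"
  proof (intro iffI ballI)
    fix x assume *: "\<forall>\<alpha>\<in>bidisk. opa n f (cnj (fst \<alpha>), cnj (snd \<alpha>)) \<noteq> 0" and "x \<in> bidisk"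
    then show "opa n f x \<noteq> 0"
      using bspec[OF *, of "(cnj (fst x), cnj (snd x))"] by (auto simp: bidisk_def)
  qed (auto simp: bidisk_def)
  then show ?thesis
    using invertible_opa_matrix_iff[OF assms] by simp
qed

end
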